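(* Let $(\mathcal{C},\varphi)$ be a noncommutative probability space, let $n\ge1$, and let $r_1,\ldots,r_n,t_1,\ldots,t_n\in\mathcal{C}$ be selfadjoint. Let $\mathbf{Q}=\mathrm{diag}(r_1^2,\ldots,r_n^2,t_1^2,\ldots,t_n^2)\in M_{2n}(\mathcal{C})$. Let $D=\mathrm{diag}(d_1,\ldots,d_{2n})$ be a diagonal matrix in $M_{2n}(\mathbb{C})$ with $\Im d_k>0$ for all $1\le k\le 2n$. Then $$G_{\mathbf{Q}}(D)=\mathrm{diag}\big(G_{r_1^2}(d_1),\ldots,G_{r_n^2}(d_n),G_{t_1^2}(d_{n+1}),\ldots,G_{t_n^2}(d_{2n})\big).$$
   Context: A noncommutative probability space $(\mathcal{C},\varphi)$ here is a unital $C^*$-algebra $\mathcal{C}$ with a positive linear functional $\varphi:\mathcal{C}\to\mathbb{C}$ with $\varphi(\mathbf{1}_{\mathcal{C}})=1$. For an integer $m\ge1$, $E:M_m(\mathcal{C})\to M_m(\mathbb{C})$ is the map applying $\varphi$ entrywise, and complex matrices are viewed in $M_m(\mathcal{C})$ via $\mathbb{C}\mathbf{1}_{\mathcal{C}}\subset\mathcal{C}$. $\mathcal{H}^+(M_m(\mathbb{C}))$ is the set of $B\in M_m(\mathbb{C})$ such that $\Im(B)=\frac{B-B^*}{2\mathrm{i}}$ is positive definite. For selfadjoint $\mathbf{X}\in M_m(\mathcal{C})$, its $M_m(\mathbb{C})$-valued Cauchy transform is $G_{\mathbf{X}}(B)=E\big((B-\mathbf{X})^{-1}\big)$ for $B\in\mathcal{H}^+(M_m(\mathbb{C}))$.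 For selfadjoint $a\in\mathcal{C}$, $G_a(\zeta)=\varphi\big((\zeta\mathbf{1}_{\mathcal{C}}-a)^{-1}\big)$ for $\Im\zeta>0$ is its scalar Cauchy transform. *)

theory Defs
  imports Complex_Main "Jordan_Normal_Form.Schur_Decomposition"
begin

text \<open>
  Nontrivial unital \<open>C\<^sup>*\<close>-algebras. The class \<^class>\<open>real_normed_algebra_1\<close> includes \<open>norm 1 = 1\<close>;
  by the \<open>C\<^sup>*\<close>-identity this is equivalent to \<open>1 \<noteq> 0\<close>, which holds whenever there is a linear
  functional with \<open>\<phi> 1 = 1\<close>.
\<close>

class cstar_algebra = real_normed_algebra_1 + banach +
  fixes scaleC :: "complex \<Rightarrow> 'a \<Rightarrow> 'a"
    and star :: "'a \<Rightarrow> 'a"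
  assumes scaleC_add_right: "scaleC c (x + y) = scaleC c x + scaleC c y"
    and scaleC_add_left: "scaleC (c + d) x = scaleC c x + scaleC d x"
    and scaleC_scaleC: "scaleC c (scaleC d x) = scaleC (c * d) x"
    and scaleC_of_real: "scaleC (complex_of_real r) x = scaleR r x"
    and scaleC_mult_left: "scaleC c x * y = scaleC c (x * y)"
    and scaleC_mult_right: "x * scaleC c y = scaleC c (x * y)"
    and norm_scaleC: "norm (scaleC c x) = cmod c * norm x"
    and star_star: "star (star x) = x"
    and star_add: "star (x + y) = star x + star y"
    and star_scaleC: "star (scaleC c x) = scaleC (cnj c) (star x)"
    and star_mult: "star (x * y) = star y * star x"
    and cstar_identity: "norm (star x * x) = (norm x)\<^sup>2"

instantiation complex :: cstar_algebra
begin

definition scaleC_complex :: "complex \<Rightarrow> complex \<Rightarrow> complex" where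
  "scaleC_complex c x = c * x"

definition star_complex :: "complex \<Rightarrow> complex" where
  "star_complex x = cnj x"

instance
  by standard
    (simp_all add: scaleC_complex_def star_complex_def algebra_simps norm_mult
      scaleR_conv_of_real power2_eq_square)

end

definition selfadjoint :: "'c::cstar_algebra \<Rightarrow> bool" where
  "selfadjoint a \<longleftrightarrow> star a = a"

text \<open>
  The order on \<^typ>\<open>complex\<close> is the one of \<^theory>\<open>HOL-Library.Complex_Order\<close>:
  \<open>0 \<le> z\<close> and \<open>0 < z\<close> include that \<open>z\<close> is real.
\<close>

locale nc_probability_space =
  fixes \<phi> :: "'c::cstar_algebra \<Rightarrow> complex"
  assumes add: "\<phi> (x + y) = \<phi> x + \<phi> y"
    and scaleC: "\<phi> (scaleC c x) = c * \<phi> x"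
    and positive: "0 \<le> \<phi> (star x * x)"
    and unit: "\<phi> 1 = 1"

definition Im_mat :: "complex mat \<Rightarrow> complex mat" where
  "Im_mat B = (1 / (2 * \<i>)) \<cdot>\<^sub>m (B - mat_adjoint B)"

definition positive_definite :: "nat \<Rightarrow> complex mat \<Rightarrow> bool" where
  "positive_definite m A \<longleftrightarrow>
     A \<in> carrier_mat m m \<and> (\<forall>v \<in> carrier_vec m. v \<noteq> 0\<^sub>v m \<longrightarrow> 0 < (A *\<^sub>v v) \<bullet>c v)"

definition upper_half_mat :: "nat \<Rightarrow> complex mat set" where
  "upper_half_mat m = {B \<in> carrier_mat m m. positive_definite m (Im_mat B)}"

definition scalar_mat :: "complex mat \<Rightarrow> 'c::cstar_algebra mat" where
  "scalar_mat B = map_mat (\<lambda>c. scaleC c 1) B"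

text \<open>
  Both Cauchy transforms are \<^const>\<open>undefined\<close> outside their half-plane. The inverses are
  two-sided inverses in the ring of \<open>m \<times> m\<close> matrices over the algebra and in the algebra itself,
  given by definite descriptions, hence unspecified for noninvertible elements.
\<close>

definition mat_cauchy ::
  "('c::cstar_algebra \<Rightarrow> complex) \<Rightarrow> nat \<Rightarrow> 'c mat \<Rightarrow> complex mat \<Rightarrow> complex mat" where
  "mat_cauchy \<phi> m X =
     (\<lambda>B \<in> upper_half_mat m. map_mat \<phi> (inv\<^bsub>ring_mat TYPE('c) m ()\<^esub> (scalar_mat B - X)))"

definition cauchy :: "('c::cstar_algebra \<Rightarrow> complex) \<Rightarrow> 'c \<Rightarrow> complex \<Rightarrow> complex" where
  "cauchy \<phi> a = (\<lambda>\<zeta> \<in> {\<zeta>. 0 < Im \<zeta>}. \<phi> (inv\<^bsub>class_ring\<^esub> (scaleC \<zeta> 1 - a)))"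

end

theory Submission
  imports Defs
begin

text \<open>
  The only analytic point is that \<open>\<zeta> - a\<close> is invertible when \<open>a\<close> is selfadjoint and
  \<open>Im \<zeta> \<noteq> 0\<close>. Following Arens, write \<open>\<zeta> - a = (\<zeta> + \<i> \<eta>) - (a + \<i> \<eta>)\<close> with \<open>\<eta>\<close> real.
  By the \<open>C\<^sup>*\<close>-identity \<open>norm (a + \<i> \<eta>)\<^sup>2 \<le> norm a\<^sup>2 + \<eta>\<^sup>2\<close>, while
  \<open>cmod (\<zeta> + \<i> \<eta>)\<^sup>2 = cmod \<zeta>\<^sup>2 + 2 \<eta> Im \<zeta> + \<eta>\<^sup>2\<close>; for a suitable \<open>\<eta>\<close> the scalar dominates and the
  Neumann series converges. The inverse of a diagonal matrix is then taken entrywise.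
\<close>

text \<open>Removing the constant term of the geometric series amounts to multiplying it by
  \<open>u\<close>, on either side. Both sides are recorded because the algebra need not be
  commutative.\<close>

lemma neumann_series_inverse:
  fixes u :: "'a::{real_normed_algebra_1,banach}"
  assumes "norm u < 1"
  shows "(1 - u) * (\<Sum>k. u ^ k) = 1" and "(\<Sum>k. u ^ k) * (1 - u) = 1"
proof -
  have s: "summable (\<lambda>k. u ^ k)"
    by (rule complete_algebra_summable_geometric[OF assms])
  have head: "(\<Sum>k. u ^ Suc k) = (\<Sum>k. u ^ k) - 1"
    using suminf_split_head[OF s] by simp
  have "(\<Sum>k. u ^ Suc k) = u * (\<Sum>k. u ^ k)"
    using suminf_mult[OF s, of u] by simp
  with head show "(1 - u) * (\<Sum>k. u ^ k) = 1"
    by (simp add: algebra_simps)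
  have "(\<Sum>k. u ^ Suc k) = (\<Sum>k. u ^ k) * u"
    using suminf_mult2[OF s, of u] by (simp add: power_commutes)
  with head show "(\<Sum>k. u ^ k) * (1 - u) = 1"
    by (simp add: algebra_simps)
qed

lemma scaleC_one: "scaleC 1 x = (x::'c::cstar_algebra)"
  using scaleC_of_real[of 1 x] by simp

lemma scaleC_zero: "scaleC 0 x = (0::'c::cstar_algebra)"
  using scaleC_of_real[of 0 x] by simp

lemma scaleC_minus_right: "scaleC c (- x) = - scaleC c (x::'c::cstar_algebra)"
proof -
  have "scaleC c 0 = (0::'c)"
    using scaleC_add_right[of c 0 0] by simp
  then show ?thesis
    using scaleC_add_right[of c x "- x"] by (simp add: eq_neg_iff_add_eq_0 add.commute)
qed

lemma scaleC_diff_right: "scaleC c (x - y) = scaleC c x - scaleC c (y::'c::cstar_algebra)"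
  using scaleC_add_right[of c x "- y"] by (simp add: scaleC_minus_right)

lemma star_one: "star 1 = (1::'c::cstar_algebra)"
  \<comment> \<open>\<open>star 1 = star 1 * star (star 1) = star (star 1 * 1) = 1\<close>.\<close>
  by (metis mult.right_neutral star_mult star_star)

text \<open>Factoring out the nonzero scalar \<open>c\<close> leaves \<open>1 - u\<close> with
  \<open>u = b / c\<close> of norm below 1, where the Neumann series applies.\<close>

lemma scalar_minus_invertible:
  fixes b :: "'c::cstar_algebra"
  assumes "norm b < cmod c"
  shows "\<exists>y. (scaleC c 1 - b) * y = 1 \<and> y * (scaleC c 1 - b) = 1"
proof -
  have c: "c \<noteq> 0"
    using assms by auto
  define u where "u = scaleC (inverse c) b"
  have "norm u < 1"
    using assms c by (simp add: u_def norm_scaleC norm_inverse pos_divide_less_eq flip: divide_inverse_commute)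
  then obtain w where w: "(1 - u) * w = 1" "w * (1 - u) = 1"
    using neumann_series_inverse by blast
  have "scaleC c 1 - b = scaleC c (1 - u)"
    using c by (simp add: u_def scaleC_diff_right scaleC_scaleC scaleC_one)
  then show ?thesis
    using w c by (intro exI[of _ "scaleC (inverse c) w"])
      (simp add: scaleC_mult_left scaleC_mult_right scaleC_scaleC scaleC_one)
qed

lemma norm_selfadjoint_add_imaginary:
  fixes a :: "'c::cstar_algebra"
  assumes "selfadjoint a"
  shows "(norm (a + scaleC (\<i> * of_real \<eta>) 1))\<^sup>2 \<le> (norm a)\<^sup>2 + \<eta>\<^sup>2"
proof -
  let ?c = "\<i> * complex_of_real \<eta>"
  have neg: "scaleC (- ?c) (1::'c) = - scaleC ?c 1"
    using scaleC_add_left[of ?c "- ?c" "1::'c"]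
    by (simp add: scaleC_zero eq_neg_iff_add_eq_0 add.commute)
  have sq: "scaleC ?c (1::'c) * scaleC ?c 1 = - scaleR (\<eta>\<^sup>2) 1"
  proof -
    have "scaleC ?c (1::'c) * scaleC ?c 1 = scaleC (?c * ?c) 1"
      by (simp add: scaleC_mult_left scaleC_scaleC)
    also have "?c * ?c = complex_of_real (- \<eta>\<^sup>2)"
      by (simp add: power2_eq_square algebra_simps)
    finally show ?thesis
      unfolding scaleC_of_real by simp
  qed
  have "star (a + scaleC ?c 1) = a - scaleC ?c 1"
    using assms neg by (simp add: selfadjoint_def star_add star_scaleC star_one)
  \<comment> \<open>Scalars are central, so the cross terms cancel; the square of the imaginary
    scalar enters with a minus sign and gives \<open>+ \<eta>\<^sup>2\<close>.\<close>
  moreover have "(a - scaleC ?c 1) * (a + scaleC ?c 1) = a * a + scaleR (\<eta>\<^sup>2) 1"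
    using sq by (simp add: algebra_simps scaleC_mult_left scaleC_mult_right scaleC_diff_right)
  ultimately have "(norm (a + scaleC ?c 1))\<^sup>2 = norm (a * a + scaleR (\<eta>\<^sup>2) 1)"
    using cstar_identity[of "a + scaleC ?c 1"] by simp
  also have "\<dots> \<le> norm (a * a) + norm (scaleR (\<eta>\<^sup>2) (1::'c))"
    by (rule norm_triangle_ineq)
  also have "\<dots> \<le> (norm a)\<^sup>2 + \<eta>\<^sup>2"
    using norm_mult_ineq[of a a] by (simp add: power2_eq_square)
  finally show ?thesis .
qed

lemma selfadjoint_resolvent_exists:
  fixes a :: "'c::cstar_algebra"
  assumes "selfadjoint a" and "Im \<zeta> \<noteq> 0"
  shows "\<exists>y. (scaleC \<zeta> 1 - a) * y = 1 \<and> y * (scaleC \<zeta> 1 - a) = 1"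
proof -
  \<comment> \<open>This choice makes the cross term \<open>2 * Im \<zeta> * \<eta>\<close> equal to
    \<open>(norm a)\<^sup>2\<close>, so the two bounds differ by exactly
    \<open>(cmod \<zeta>)\<^sup>2 > 0\<close>. The sign of \<eta> follows that of
    \<open>Im \<zeta>\<close>, which covers both half-planes.\<close>
  define \<eta> where "\<eta> = (norm a)\<^sup>2 / (2 * Im \<zeta>)"
  let ?c = "\<i> * complex_of_real \<eta>"
  have "(norm (a + scaleC ?c 1))\<^sup>2 \<le> (norm a)\<^sup>2 + \<eta>\<^sup>2"
    by (rule norm_selfadjoint_add_imaginary[OF assms(1)])
  also have "\<dots> < (Re \<zeta>)\<^sup>2 + (Im \<zeta>)\<^sup>2 + 2 * Im \<zeta> * \<eta> + \<eta>\<^sup>2"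
  proof -
    have "0 < (Re \<zeta>)\<^sup>2 + (Im \<zeta>)\<^sup>2"
      using assms(2) by (simp add: add_nonneg_pos)
    moreover have "2 * Im \<zeta> * \<eta> = (norm a)\<^sup>2"
      using assms(2) by (simp add: \<eta>_def)
    ultimately show ?thesis
      by linarith
  qed
  also have "\<dots> = (cmod (\<zeta> + ?c))\<^sup>2"
    unfolding cmod_power2 by (simp add: power2_eq_square algebra_simps)
  finally have "norm (a + scaleC ?c 1) < cmod (\<zeta> + ?c)"
    by (rule power_less_imp_less_base) simp
  \<comment> \<open>The shift by \<open>?c\<close> cancels in the difference, leaving
    \<open>\<zeta> - a\<close>.\<close>
  from scalar_minus_invertible[OF this] show ?thesis
    by (simp add: scaleC_add_left)
qed

lemma selfadjoint_power2: "selfadjoint a \<Longrightarrow> selfadjoint (a\<^sup>2)"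
  by (simp add: selfadjoint_def power2_eq_square star_mult)

text \<open>Two-sided inverses in a monoid are unique, so exhibiting one determines the definite
  description behind \<open>inv\<close>.\<close>

lemma inv_class_ring_eqI:
  fixes x y :: "'a::ring_1"
  assumes "x * y = 1" and "y * x = 1"
  shows "inv\<^bsub>class_ring\<^esub> x = y"
proof -
  have "monoid (class_ring :: 'a ring)"
    by unfold_locales (auto simp: mult.assoc)
  from monoid.inv_unique'[OF this, of x y] show ?thesis
    using assms by simp
qed

lemma inv_ring_mat_eqI:
  fixes A B :: "'a::ring_1 mat"
  assumes "A \<in> carrier_mat m m" and "B \<in> carrier_mat m m"
    and "A * B = 1\<^sub>m m" and "B * A = 1\<^sub>m m"
  shows "inv\<^bsub>ring_mat TYPE('a) m ()\<^esub> A = B"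
proof -
  interpret monoid "ring_mat TYPE('a) m ()"
    by unfold_locales (auto simp: ring_mat_def assoc_mult_mat)
  show ?thesis
    using inv_unique'[of A B] assms by (simp add: ring_mat_def)
qed

lemma mat_diag_cong: "(\<And>k. k < m \<Longrightarrow> f k = g k) \<Longrightarrow> mat_diag m f = mat_diag m g"
  by (auto simp: mat_diag_def intro!: eq_matI)

lemma inv_mat_diag:
  fixes f g :: "nat \<Rightarrow> 'a::ring_1"
  assumes "\<And>k. k < m \<Longrightarrow> f k * g k = 1" and "\<And>k. k < m \<Longrightarrow> g k * f k = 1"
  shows "inv\<^bsub>ring_mat TYPE('a) m ()\<^esub> (mat_diag m f) = mat_diag m g"
proof (rule inv_ring_mat_eqI)
  show "mat_diag m f * mat_diag m g = 1\<^sub>m m"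
    using assms(1) mat_diag_cong[of m "\<lambda>k. f k * g k" "\<lambda>k. 1"] by simp
  show "mat_diag m g * mat_diag m f = 1\<^sub>m m"
    using assms(2) mat_diag_cong[of m "\<lambda>k. g k * f k" "\<lambda>k. 1"] by simp
qed simp_all

lemma Im_mat_diag: "Im_mat (mat_diag m d) = mat_diag m (\<lambda>k. complex_of_real (Im (d k)))"
proof (rule eq_matI)
  fix i j
  assume "i < dim_row (mat_diag m (\<lambda>k. complex_of_real (Im (d k))))"
    and "j < dim_col (mat_diag m (\<lambda>k. complex_of_real (Im (d k))))"
  then show "Im_mat (mat_diag m d) $$ (i, j) = mat_diag m (\<lambda>k. complex_of_real (Im (d k))) $$ (i, j)"
    by (auto simp: Im_mat_def mat_diag_def mat_adjoint_def mat_of_rows_def complex_eq_iff)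
qed (auto simp: Im_mat_def mat_diag_def mat_adjoint_def)

lemma mat_diag_mult_vec:
  fixes f :: "nat \<Rightarrow> 'a::semiring_0"
  assumes "v \<in> carrier_vec m"
  shows "mat_diag m f *\<^sub>v v = vec m (\<lambda>k. f k * v $ k)"
proof (rule eq_vecI)
  fix i
  assume "i < dim_vec (vec m (\<lambda>k. f k * v $ k))"
  then have i: "i < m"
    by simp
  have "(mat_diag m f *\<^sub>v v) $ i = (\<Sum>j = 0..<m. if i = j then f j * v $ j else 0)"
    using assms i by (auto simp: mat_diag_def scalar_prod_def simp del: sum.delta sum.delta' intro!: sum.cong)
  then show "(mat_diag m f *\<^sub>v v) $ i = vec m (\<lambda>k. f k * v $ k) $ i"
    using i by simp
qed (simp add: mat_diag_def)

text \<open>The quadratic form of the imaginary part at \<open>v\<close> is the sum of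
  \<open>Im (d k) * (cmod (v $ k))\<^sup>2\<close>: no term is negative, and a nonzero coordinate of
  \<open>v\<close> makes one positive.\<close>

lemma mat_diag_in_upper_half_mat:
  assumes "\<And>k. k < m \<Longrightarrow> 0 < Im (d k)"
  shows "mat_diag m d \<in> upper_half_mat m"
proof -
  have "0 < (mat_diag m (\<lambda>k. complex_of_real (Im (d k))) *\<^sub>v v) \<bullet>c v"
    if v: "v \<in> carrier_vec m" "v \<noteq> 0\<^sub>v m" for v
  proof -
    obtain i where i: "i < m" "v $ i \<noteq> 0"
      using v by (metis carrier_vecD eq_vecI index_zero_vec)
    have "(mat_diag m (\<lambda>k. complex_of_real (Im (d k))) *\<^sub>v v) \<bullet>c v
        = (\<Sum>k = 0..<m. complex_of_real (Im (d k)) * v $ k * cnj (v $ k))"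
      using v by (auto simp: mat_diag_mult_vec scalar_prod_def intro!: sum.cong)
    \<comment> \<open>The order on complex numbers compares only numbers with equal imaginary parts,
      so the form is first exhibited as a real number.\<close>
    also have "\<dots> = complex_of_real (\<Sum>k = 0..<m. Im (d k) * (cmod (v $ k))\<^sup>2)"
      by (simp add: mult.assoc flip: complex_norm_square)
    finally have eq: "(mat_diag m (\<lambda>k. complex_of_real (Im (d k))) *\<^sub>v v) \<bullet>c v
        = complex_of_real (\<Sum>k = 0..<m. Im (d k) * (cmod (v $ k))\<^sup>2)" .
    have "0 < (\<Sum>k = 0..<m. Im (d k) * (cmod (v $ k))\<^sup>2)"
      by (rule sum_pos2[of _ i]) (use i assms in \<open>auto simp: less_imp_le\<close>)
    then show ?thesis
      unfolding eq by (simp add: less_complex_def)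
  qed
  then show ?thesis
    by (simp add: upper_half_mat_def positive_definite_def Im_mat_diag)
qed

lemma mat_cauchy_mat_diag:
  fixes \<phi> :: "'c::cstar_algebra \<Rightarrow> complex"
  assumes "nc_probability_space \<phi>"
    and sa: "\<And>k. k < m \<Longrightarrow> selfadjoint (a k)"
    and im: "\<And>k. k < m \<Longrightarrow> 0 < Im (d k)"
  shows "mat_cauchy \<phi> m (mat_diag m a) (mat_diag m d) = mat_diag m (\<lambda>k. cauchy \<phi> (a k) (d k))"
proof -
  interpret nc_probability_space \<phi>
    by fact
  \<comment> \<open>Keeps the off-diagonal entries zero when \<phi> is applied entrywise.\<close>
  have phi0: "\<phi> 0 = 0"
    using add[of 0 0] by simp
  have "\<exists>y. (scaleC (d k) 1 - a k) * y = 1 \<and> y * (scaleC (d k) 1 - a k) = 1" if "k < m" for k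
    using selfadjoint_resolvent_exists[OF sa[OF that], of "d k"] im[OF that] by simp
  then obtain g where g: "\<And>k. k < m \<Longrightarrow> (scaleC (d k) 1 - a k) * g k = 1"
      "\<And>k. k < m \<Longrightarrow> g k * (scaleC (d k) 1 - a k) = 1"
    by metis
  have diff: "scalar_mat (mat_diag m d) - mat_diag m a = mat_diag m (\<lambda>k. scaleC (d k) 1 - a k)"
    by (rule eq_matI) (auto simp: scalar_mat_def mat_diag_def scaleC_zero)
  \<comment> \<open>Membership of the diagonal matrix in the matrix half-plane lets the restricted
    function be evaluated; its resolvent is the diagonal of the scalar inverses
    \<open>g k\<close>.\<close>
  have "mat_cauchy \<phi> m (mat_diag m a) (mat_diag m d) = map_mat \<phi> (mat_diag m g)"
    using im by (simp add: mat_cauchy_def mat_diag_in_upper_half_mat diff inv_mat_diag[OF g])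
  also have "\<dots> = mat_diag m (\<lambda>k. \<phi> (g k))"
    by (rule eq_matI) (auto simp: mat_diag_def phi0)
  \<comment> \<open>By uniqueness the same \<open>g k\<close> is the inverse inside
    \<open>cauchy\<close>, and \<open>d k\<close> lies in its half-plane.\<close>
  also have "\<dots> = mat_diag m (\<lambda>k. cauchy \<phi> (a k) (d k))"
    using im inv_class_ring_eqI[OF g] by (intro mat_diag_cong) (simp add: cauchy_def)
  finally show ?thesis .
qed

theorem theorem3:
  fixes \<phi> :: "'c::cstar_algebra \<Rightarrow> complex"
    and n :: nat
    and r t :: "nat \<Rightarrow> 'c"
    and d :: "nat \<Rightarrow> complex"
    and Q :: "'c mat"
    and D :: "complex mat"
  assumes "nc_probability_space \<phi>"
    and "1 \<le> n"
    and "\<And>k. k < n \<Longrightarrow> selfadjoint (r k)"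
    and "\<And>k. k < n \<Longrightarrow> selfadjoint (t k)"
    and "\<And>k. k < 2 * n \<Longrightarrow> 0 < Im (d k)"
    and "Q = mat_diag (2 * n) (\<lambda>k. if k < n then (r k)\<^sup>2 else (t (k - n))\<^sup>2)"
    and "D = mat_diag (2 * n) d"
  shows "mat_cauchy \<phi> (2 * n) Q D =
    mat_diag (2 * n) (\<lambda>k. if k < n then cauchy \<phi> ((r k)\<^sup>2) (d k)
                          else cauchy \<phi> ((t (k - n))\<^sup>2) (d k))"
proof -
  let ?a = "\<lambda>k. if k < n then (r k)\<^sup>2 else (t (k - n))\<^sup>2"
  \<comment> \<open>Indices start at 0, so in the second block \<open>k - n < n\<close> holds and
    the hypothesis on \<open>t\<close> applies.\<close>
  have "selfadjoint (?a k)" if "k < 2 * n" for k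
    using that assms(3)[of k] assms(4)[of "k - n"] by (auto intro!: selfadjoint_power2)
  then have "mat_cauchy \<phi> (2 * n) Q D = mat_diag (2 * n) (\<lambda>k. cauchy \<phi> (?a k) (d k))"
    unfolding assms(6,7) by (intro mat_cauchy_mat_diag assms(1,5))
  also have "\<dots> = mat_diag (2 * n) (\<lambda>k. if k < n then cauchy \<phi> ((r k)\<^sup>2) (d k)
                          else cauchy \<phi> ((t (k - n))\<^sup>2) (d k))"
    by (rule mat_diag_cong) simp
  finally show ?thesis .
qed

end
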